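(* Let $A\in\mathbb{C}^{n\times n}$ have index $k$ and satisfy $\operatorname{rank}(A^{\sim}AA^{\sim})=\operatorname{rank}(A)$. Then: (1) $\operatorname{rank}(A^{D,\mathfrak{m}})=\operatorname{rank}(A^{k})$; (2) $\mathcal{R}(A^{D,\mathfrak{m}})=\mathcal{R}(A^{k})$ and $\mathcal{N}(A^{D,\mathfrak{m}})=\mathcal{N}(A^{k}A^{\mathfrak{m}})$; (3) $A^{D,\mathfrak{m}}=A^{(2)}_{\mathcal{R}(A^{k}),\mathcal{N}(A^{k}A^{\mathfrak{m}})}$; (4) $AA^{D,\mathfrak{m}}=P_{\mathcal{R}(A^{k}),\mathcal{N}(A^{k}A^{\mathfrak{m}})}$; (5) $A^{D,\mathfrak{m}}A=A^{D}A=P_{\mathcal{R}(A^{k}),\mathcal{N}(A^{k})}$.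
   Context: $\mathcal{R}(\cdot)$ and $\mathcal{N}(\cdot)$ denote range and null space. For subspaces with $\mathcal{S}\oplus\mathcal{T}=\mathbb{C}^n$, $P_{\mathcal{S},\mathcal{T}}$ is the projector onto $\mathcal{S}$ along $\mathcal{T}$. A matrix $X$ is an outer inverse of $A$ if $XAX=X$; $A^{(2)}_{\mathcal{T},\mathcal{S}}$ denotes the (unique, if it exists) outer inverse $X$ of $A$ with $\mathcal{R}(X)=\mathcal{T}$ and $\mathcal{N}(X)=\mathcal{S}$. The index of $A\in\mathbb{C}^{n\times n}$ is the smallest nonnegative integer $k$ with $\operatorname{rank}(A^{k+1})=\operatorname{rank}(A^{k})$. The Minkowski metric matrix of order $n$ is $G=\operatorname{diag}(1,-I_{n-1})$. For $A\in\mathbb{C}^{n\times n}$, the Minkowski adjoint is $A^{\sim}=GA^{*}G$, where $A^*$ is the conjugate transpose. The Drazin inverse $A^{D}$ of $A$ (of index $k$) is the unique $X$ with $XAX=X$, $AX=XA$, $A^{k+1}X=A^{k}$. The Minkowski inverse $A^{\mathfrak{m}}$ is the unique matrix $X$ (if it exists) with $AXA=A$, $XAX=X$, $(AX)^{\sim}=AX$, $(XA)^{\sim}=XA$; it exists if and only if $\operatorname{rank}(A^{\sim}AA^{\sim})=\operatorname{rank}(A)$. When it exists, the $\mathfrak{m}$-DMP inverse of $A$ is $A^{D,\mathfrak{m}}=A^{D}AA^{\mathfrak{m}}$. *)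

theory Defs
  imports
    Complex_Main
    "Jordan_Normal_Form.Conjugate"
    "Jordan_Normal_Form.Schur_Decomposition"
    "Jordan_Normal_Form.Matrix_Kernel"
    "Jordan_Normal_Form.DL_Rank"
begin

text \<open>The null space is \<^const>\<open>mat_kernel\<close>. Matrices carry their dimensions, so the ambient
  dimension that the locale constants of \<^locale>\<open>vec_space\<close> expect is read off the matrix.\<close>

definition mat_rank :: "complex mat \<Rightarrow> nat" where
  "mat_rank A = vec_space.rank (dim_row A) A"

definition mat_range :: "complex mat \<Rightarrow> complex vec set" where
  "mat_range A = {A *\<^sub>v x | x. x \<in> carrier_vec (dim_col A)}"

lemma mat_range_col_space:
  "mat_range A = vec_space.col_space (dim_row A) A"
proof -
  interpret vec_space "TYPE(complex)" "dim_row A" .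
  show ?thesis
    unfolding mat_range_def by (subst col_space_eq) (auto intro: mult_mat_vec_carrier)
qed

definition mat_index :: "complex mat \<Rightarrow> nat" where
  "mat_index A = (LEAST k. mat_rank (A ^\<^sub>m (k + 1)) = mat_rank (A ^\<^sub>m k))"

definition minkowski_metric :: "nat \<Rightarrow> complex mat" where
  "minkowski_metric n =
     mat n n (\<lambda>(i, j). if i = j then (if i = 0 then 1 else -1) else 0)"

text \<open>For square matrices only: both metric matrices have the order of \<open>A\<close>.\<close>

definition minkowski_adjoint :: "complex mat \<Rightarrow> complex mat" where
  "minkowski_adjoint A =
     minkowski_metric (dim_row A) * mat_adjoint A * minkowski_metric (dim_row A)"

definition is_drazin_inverse :: "complex mat \<Rightarrow> complex mat \<Rightarrow> bool" where
  "is_drazin_inverse A X \<longleftrightarrow>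
     X \<in> carrier_mat (dim_row A) (dim_row A) \<and>
     X * A * X = X \<and> A * X = X * A \<and>
     A ^\<^sub>m (mat_index A + 1) * X = A ^\<^sub>m (mat_index A)"

definition drazin_inverse :: "complex mat \<Rightarrow> complex mat" where
  "drazin_inverse A = (THE X. is_drazin_inverse A X)"

definition is_minkowski_inverse :: "complex mat \<Rightarrow> complex mat \<Rightarrow> bool" where
  "is_minkowski_inverse A X \<longleftrightarrow>
     X \<in> carrier_mat (dim_row A) (dim_row A) \<and>
     A * X * A = A \<and> X * A * X = X \<and>
     minkowski_adjoint (A * X) = A * X \<and>
     minkowski_adjoint (X * A) = X * A"

definition minkowski_inverse :: "complex mat \<Rightarrow> complex mat" where
  "minkowski_inverse A = (THE X. is_minkowski_inverse A X)"

definition m_DMP_inverse :: "complex mat \<Rightarrow> complex mat" where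
  "m_DMP_inverse A = drazin_inverse A * A * minkowski_inverse A"

definition is_outer_inverse :: "complex mat \<Rightarrow> complex mat \<Rightarrow> bool" where
  "is_outer_inverse A X \<longleftrightarrow>
     X \<in> carrier_mat (dim_col A) (dim_row A) \<and> X * A * X = X"

text \<open>\<open>outer_inverse_TS A T S\<close> is the outer inverse with range \<open>T\<close> and null space \<open>S\<close>; it need
  not exist for arbitrary \<open>T\<close> and \<open>S\<close>.\<close>

definition is_outer_inverse_TS ::
  "complex mat \<Rightarrow> complex vec set \<Rightarrow> complex vec set \<Rightarrow> complex mat \<Rightarrow> bool" where
  "is_outer_inverse_TS A T S X \<longleftrightarrow>
     is_outer_inverse A X \<and> mat_range X = T \<and> mat_kernel X = S"

definition outer_inverse_TS ::
  "complex mat \<Rightarrow> complex vec set \<Rightarrow> complex vec set \<Rightarrow> complex mat" where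
  "outer_inverse_TS A T S = (THE X. is_outer_inverse_TS A T S X)"

text \<open>\<open>S\<close> and \<open>T\<close> are subspaces of \<open>\<complex>\<^sup>n\<close> whose internal direct sum is \<open>\<complex>\<^sup>n\<close>.\<close>

definition complementary_subspaces ::
  "nat \<Rightarrow> complex vec set \<Rightarrow> complex vec set \<Rightarrow> bool" where
  "complementary_subspaces n S T \<longleftrightarrow>
     VectorSpace.subspace class_ring S (module_vec TYPE(complex) n) \<and>
     VectorSpace.subspace class_ring T (module_vec TYPE(complex) n) \<and>
     {s + t | s t. s \<in> S \<and> t \<in> T} = carrier_vec n \<and>
     S \<inter> T = {0\<^sub>v n}"

text \<open>The projector onto \<open>S\<close> along \<open>T\<close>; meaningful only for complementary subspaces.\<close>

definition projector ::
  "nat \<Rightarrow> complex vec set \<Rightarrow> complex vec set \<Rightarrow> complex mat" where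
  "projector n S T =
     (THE P. P \<in> carrier_mat n n \<and> (\<forall>s\<in>S. \<forall>t\<in>T. P *\<^sub>v (s + t) = s))"

end

theory Submission
  imports Defs
begin

text \<open>
  Let \<open>D\<close> be the Drazin and \<open>M\<close> the Minkowski inverse of \<open>A\<close>, and put \<open>B = A\<^sup>k\<close>, \<open>E = D * A\<close> and
  \<open>X = E * M\<close>, the m-DMP inverse. Once the two inverses are known to exist, the theorem is a
  calculation. The matrix \<open>E\<close> is idempotent, fixes \<open>B\<close> from both sides, and is divisible by \<open>B\<close>
  on both sides (\<open>drazin_projection_factors\<close>); hence it has the range and the null space of \<open>B\<close>.
  As \<open>A * M * A = A\<close>, it follows that \<open>X * A = E\<close> and \<open>X * A * X = X\<close>, so \<open>A * X\<close> is idempotent too.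
  Factoring \<open>X\<close> and \<open>A * X\<close> through \<open>B\<close> on the left and \<open>B * M\<close> on the right, and conversely,
  gives their ranges and null spaces. An idempotent is the projector onto its range
  along its null space (\<open>idempotent_projector\<close>), and an outer inverse is determined by its range
  and null space (\<open>outer_inverse_unique\<close>).

  Both inverses exist because of an equality of ranks, and the link is the same: if
  \<open>P * Q\<close> has the rank of \<open>P\<close>, then \<open>P = P * Q * Y\<close> for some \<open>Y\<close>, and similarly on the other side
  (\<open>right_factor_if_rank_mult_eq\<close>, \<open>left_factor_if_rank_mult_eq\<close>). The left-hand version rests on the
  equality of row and column rank, which follows from rank factorizations. The cofactors then
  yield explicit formulas for the two inverses: \<open>B * U\<close> with \<open>B * A * B * U = B\<close> for the Drazin
  inverse, and \<open>Y\<^sup>~ A Z\<^sup>~\<close> with \<open>A = A A\<^sup>~ Y = Z A\<^sup>~ A\<close> for the Minkowski inverse, where \<open>A\<^sup>~\<close> is the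
  Minkowski adjoint.
\<close>

section \<open>Range, rank and factorization\<close>

lemma mat_range_mult_subset:
  assumes "A \<in> carrier_mat m n" "B \<in> carrier_mat n p"
  shows "mat_range (A * B) \<subseteq> mat_range A"
  using assms unfolding mat_range_def by auto

lemma eq_mat_if_mult_vec_eq:
  fixes X Y :: "complex mat"
  assumes "X \<in> carrier_mat m n" "Y \<in> carrier_mat m n"
    and "\<And>v. v \<in> carrier_vec n \<Longrightarrow> X *\<^sub>v v = Y *\<^sub>v v"
  shows "X = Y"
proof (rule mat_col_eqI)
  fix i assume i: "i < dim_col Y"
  then have i: "i < n" using assms by simp
  have "col X i = X *\<^sub>v col (1\<^sub>m n) i" "col Y i = Y *\<^sub>v col (1\<^sub>m n) i"
    using assms i col_mult2[of X m n "1\<^sub>m n" n i] col_mult2[of Y m n "1\<^sub>m n" n i] by auto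
  moreover have "col (1\<^sub>m n) i \<in> carrier_vec n" by (metis col_dim index_one_mat(2))
  ultimately show "col X i = col Y i" using assms(3) by metis
qed (use assms in auto)

text \<open>Each column of \<open>B\<close> lies in the range of \<open>A\<close>; preimages of the columns are the
  columns of \<open>Y\<close>. This turns inclusions of ranges into matrix equations.\<close>
lemma factor_if_mat_range_subset:
  assumes A: "A \<in> carrier_mat m n" and B: "B \<in> carrier_mat m p"
    and sub: "mat_range B \<subseteq> mat_range A"
  obtains Y where "Y \<in> carrier_mat n p" "B = A * Y"
proof -
  have "\<exists>y. y \<in> carrier_vec n \<and> col B j = A *\<^sub>v y" if "j < p" for j
  proof -
    have "col B j = B *\<^sub>v col (1\<^sub>m p) j"
      using B that col_mult2[of B m p "1\<^sub>m p" p j] by auto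
    moreover have "col (1\<^sub>m p) j \<in> carrier_vec p" by (metis col_dim index_one_mat(2))
    ultimately have "col B j \<in> mat_range B" using B unfolding mat_range_def by auto
    then have "col B j \<in> mat_range A" using sub by blast
    then show ?thesis using A unfolding mat_range_def by auto
  qed
  then obtain f where f: "\<And>j. j < p \<Longrightarrow> f j \<in> carrier_vec n \<and> col B j = A *\<^sub>v f j" by metis
  define Y where "Y = mat_of_cols n (map f [0..<p])"
  have Y: "Y \<in> carrier_mat n p" using mat_of_cols_carrier(1)[of n "map f [0..<p]"] by (simp add: Y_def)
  have "B = A * Y"
  proof (rule mat_col_eqI)
    fix i assume "i < dim_col (A * Y)"
    then have i: "i < p" using Y by simp
    then have "col Y i = f i" using f by (simp add: Y_def)
    then show "col B i = col (A * Y) i" using f[OF i] col_mult2[OF A Y i] by simp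
  qed (use A B Y in auto)
  with Y show ?thesis using that by blast
qed

text \<open>An independent set with as many elements as the dimension is a basis of the span.\<close>
lemma (in vec_space) span_eq_if_card_eq_dim:
  assumes W: "W \<subseteq> carrier_vec n" "finite W"
    and S: "S \<subseteq> span W" "lin_indpt S" "finite S"
    and card: "card S = vectorspace.dim class_ring (span_vs W)"
  shows "span S = span W"
proof -
  have W': "W \<subseteq> carrier V" using W by simp
  have sub: "submodule class_ring (span W) V" using span_is_submodule[OF W(1)] .
  have vs: "vectorspace class_ring (span_vs W)"
    using span_is_subspace[OF W(1), THEN subspace_is_vs] .
  have fin: "vectorspace.fin_dim class_ring (span_vs W)"
    using fin_dim_span[OF W(2) W'] .
  have "LinearCombinations.module.lin_indpt class_ring (span_vs W) S"
    using span_li_not_depend(2)[OF S(1) sub] S(2) by simp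
  then have "vectorspace.basis class_ring (span_vs W) S"
    using vectorspace.dim_li_is_basis[OF vs fin S(3)] S(1) card by simp
  then show ?thesis
    using span_li_not_depend(1)[OF S(1) sub] vectorspace.basis_def[OF vs] by simp
qed

text \<open>A maximal independent set of columns, which by \<open>span_eq_if_card_eq_dim\<close> spans the range of any
  matrix of the same rank whose range contains it.\<close>
lemma ex_indpt_cols_card_eq_rank:
  assumes A: "A \<in> carrier_mat m n"
  obtains S where "S \<subseteq> set (cols A)" "card S = mat_rank A"
     "\<not> LinearCombinations.module.lin_dep class_ring (module_vec TYPE(complex) m) S"
proof -
  interpret vec_space "TYPE(complex)" m .
  obtain S where S: "finite S" "maximal S (\<lambda>T. T \<subseteq> set (cols A) \<and> lin_indpt T)"
    using maximal_exists_superset[of "set (cols A)" "\<lambda>T. T \<subseteq> set (cols A) \<and> lin_indpt T" "{}"]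
      finite_lin_indpt2 by blast
  have "card S = mat_rank A"
    using rank_card_indpt[OF A S(2)] A by (simp add: mat_rank_def)
  then show ?thesis using that S(2) unfolding maximal_def by blast
qed

lemma mat_range_eq_if_rank_eq:
  assumes P: "P \<in> carrier_mat m p" and Q: "Q \<in> carrier_mat m q"
    and sub: "mat_range P \<subseteq> mat_range Q" and rk: "mat_rank P = mat_rank Q"
  shows "mat_range P = mat_range Q"
proof -
  interpret vec_space "TYPE(complex)" m .
  have spP: "mat_range P = span (set (cols P))" and spQ: "mat_range Q = span (set (cols Q))"
    using P Q by (simp_all add: mat_range_col_space col_space_def)
  have cP: "set (cols P) \<subseteq> carrier_vec m" and cQ: "set (cols Q) \<subseteq> carrier_vec m"
    using P Q cols_dim by blast+
  obtain S where S: "S \<subseteq> set (cols P)" "card S = mat_rank P" "lin_indpt S"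
    using ex_indpt_cols_card_eq_rank[OF P] by blast
  have fin: "finite S" using S(1) finite_subset by blast
  have "S \<subseteq> span (set (cols P))" using S(1) in_own_span[of "set (cols P)"] cP by auto
  then have "S \<subseteq> span (set (cols Q))" using sub spP spQ by auto
  then have "span S = span (set (cols Q))"
    using span_eq_if_card_eq_dim[OF cQ _ _ S(3) fin] S(2) rk Q by (simp add: mat_rank_def rank_def)
  moreover have "span S \<subseteq> span (set (cols P))" using span_is_monotone[OF S(1)] .
  ultimately show ?thesis using sub spP spQ by auto
qed

lemma mat_rank_mono:
  assumes P: "P \<in> carrier_mat m p" and Q: "Q \<in> carrier_mat m q"
    and sub: "mat_range P \<subseteq> mat_range Q"
  shows "mat_rank P \<le> mat_rank Q"
proof -
  interpret vec_space "TYPE(complex)" m .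
  have spP: "mat_range P = span (set (cols P))" and spQ: "mat_range Q = span (set (cols Q))"
    using P Q by (simp_all add: mat_range_col_space col_space_def)
  have cP: "set (cols P) \<subseteq> carrier_vec m" and cQ: "set (cols Q) \<subseteq> carrier_vec m"
    using P Q cols_dim[of P] cols_dim[of Q] by auto
  have "VectorSpace.subspace class_ring (span (set (cols P))) (span_vs (set (cols Q)))"
    using nested_subspaces[OF span_is_subspace[OF cQ] span_is_subspace[OF cP]] sub spP spQ by simp
  then show ?thesis
    using vectorspace.subspace_dim[OF span_is_subspace[OF cQ, THEN subspace_is_vs] _
        fin_dim_span_cols[OF Q]] fin_dim_span_cols[OF P] P Q
    by (simp add: mat_rank_def rank_def)
qed

text \<open>The columns of \<open>C\<close> are a basis of the range of \<open>A\<close> chosen among the columns of \<open>A\<close>. The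
  factorization makes the rank symmetric in rows and columns.\<close>
lemma rank_factorization:
  assumes A: "A \<in> carrier_mat m n"
  obtains C F where "C \<in> carrier_mat m (mat_rank A)" "F \<in> carrier_mat (mat_rank A) n" "A = C * F"
proof -
  interpret vec_space "TYPE(complex)" m .
  have cA: "set (cols A) \<subseteq> carrier_vec m" using A cols_dim by blast
  obtain S where S: "S \<subseteq> set (cols A)" "card S = mat_rank A" "lin_indpt S"
    using ex_indpt_cols_card_eq_rank[OF A] by blast
  then have fin: "finite S" using finite_subset by blast
  then obtain xs where xs: "set xs = S" "distinct xs" using finite_distinct_list by blast
  have len: "length xs = mat_rank A" using xs S(2) distinct_card by metis
  define C where "C = mat_of_cols m xs"
  have C: "C \<in> carrier_mat m (mat_rank A)" unfolding C_def using mat_of_cols_carrier(1) len by metis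
  have "set xs \<subseteq> carrier_vec m" using xs S(1) cA by blast
  then have "set (cols C) = S" by (simp add: C_def xs)
  moreover have "S \<subseteq> span (set (cols A))"
    using S(1) in_own_span[OF cA] by simp
  then have "span S = span (set (cols A))"
    using span_eq_if_card_eq_dim[OF cA _ _ S(3) fin] S(2) A by (simp add: mat_rank_def rank_def)
  ultimately have "mat_range C = mat_range A"
    using A C by (simp add: mat_range_col_space col_space_def)
  then obtain F where "F \<in> carrier_mat (mat_rank A) n" "A = C * F"
    using factor_if_mat_range_subset[OF C A] by auto
  then show ?thesis by (rule that[OF C])
qed

lemma mat_rank_mult_le_dim:
  assumes C: "C \<in> carrier_mat m r" and F: "F \<in> carrier_mat r n"
  shows "mat_rank (C * F) \<le> r"
proof -
  have "mat_rank (C * F) \<le> mat_rank C"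
    by (rule mat_rank_mono[OF _ C mat_range_mult_subset[OF C F]]) (use C F in auto)
  also have "\<dots> \<le> r" using vec_space.rank_le_nc[OF C] C by (simp add: mat_rank_def)
  finally show ?thesis .
qed

text \<open>Transposing a rank factorization of \<open>A\<close> factors the transpose through the same dimension.\<close>
lemma mat_rank_transpose_le:
  assumes "A \<in> carrier_mat m n"
  shows "mat_rank A\<^sup>T \<le> mat_rank A"
proof -
  obtain C F where C: "C \<in> carrier_mat m (mat_rank A)" and F: "F \<in> carrier_mat (mat_rank A) n"
    and A: "A = C * F"
    by (rule rank_factorization[OF assms])
  have "mat_rank (F\<^sup>T * C\<^sup>T) \<le> mat_rank A"
    by (rule mat_rank_mult_le_dim) (use C F in auto)
  moreover have "A\<^sup>T = F\<^sup>T * C\<^sup>T" using transpose_mult[OF C F] by (simp only: A[symmetric])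
  ultimately show ?thesis by simp
qed

lemma mat_rank_transpose: "mat_rank A\<^sup>T = mat_rank A"
proof (rule antisym)
  show "mat_rank A\<^sup>T \<le> mat_rank A"
    by (rule mat_rank_transpose_le[of A "dim_row A" "dim_col A"]) auto
  have "mat_rank (A\<^sup>T)\<^sup>T \<le> mat_rank A\<^sup>T"
    by (rule mat_rank_transpose_le[of "A\<^sup>T" "dim_col A" "dim_row A"]) auto
  then show "mat_rank A \<le> mat_rank A\<^sup>T" by simp
qed

lemma mat_rank_mult_le_left:
  assumes "A \<in> carrier_mat m n" "B \<in> carrier_mat n p"
  shows "mat_rank (A * B) \<le> mat_rank A"
  by (rule mat_rank_mono[OF _ assms(1) mat_range_mult_subset[OF assms]]) (use assms in auto)

lemma mat_rank_mult_le_right: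
  assumes "A \<in> carrier_mat m n" "B \<in> carrier_mat n p"
  shows "mat_rank (A * B) \<le> mat_rank B"
proof -
  have "mat_rank (A * B) = mat_rank (B\<^sup>T * A\<^sup>T)"
    unfolding transpose_mult[OF assms, symmetric] mat_rank_transpose ..
  also have "\<dots> \<le> mat_rank B\<^sup>T"
    by (rule mat_rank_mult_le_left) (use assms in auto)
  finally show ?thesis unfolding mat_rank_transpose .
qed

text \<open>Multiplication by \<open>B\<close> does not shrink the range of \<open>A\<close>, so \<open>A\<close> factors through \<open>A * B\<close>.\<close>
lemma right_factor_if_rank_mult_eq:
  assumes A: "A \<in> carrier_mat m n" and B: "B \<in> carrier_mat n p"
    and rk: "mat_rank (A * B) = mat_rank A"
  obtains Y where "Y \<in> carrier_mat p n" "A = A * B * Y"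
proof -
  have AB: "A * B \<in> carrier_mat m p" using A B by simp
  have "mat_range A \<subseteq> mat_range (A * B)"
    using mat_range_eq_if_rank_eq[OF AB A mat_range_mult_subset[OF A B] rk] by simp
  then obtain Y where "Y \<in> carrier_mat p n" "A = A * B * Y"
    by (rule factor_if_mat_range_subset[OF AB A])
  then show ?thesis by (rule that)
qed

text \<open>The row version, by transposition.\<close>
lemma left_factor_if_rank_mult_eq:
  assumes A: "A \<in> carrier_mat m n" and B: "B \<in> carrier_mat n p"
    and rk: "mat_rank (A * B) = mat_rank B"
  obtains Z where "Z \<in> carrier_mat n m" "B = Z * (A * B)"
proof -
  have AT: "A\<^sup>T \<in> carrier_mat n m" and BT: "B\<^sup>T \<in> carrier_mat p n" using A B by auto
  have T: "(A * B)\<^sup>T = B\<^sup>T * A\<^sup>T" by (rule transpose_mult[OF A B])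
  have "mat_rank (B\<^sup>T * A\<^sup>T) = mat_rank B\<^sup>T"
    unfolding T[symmetric] mat_rank_transpose by (rule rk)
  then obtain Y where Y: "Y \<in> carrier_mat m n" "B\<^sup>T = B\<^sup>T * A\<^sup>T * Y"
    by (rule right_factor_if_rank_mult_eq[OF BT AT])
  have "B = (B\<^sup>T * A\<^sup>T * Y)\<^sup>T" unfolding Y(2)[symmetric] by simp
  also have "\<dots> = Y\<^sup>T * (B\<^sup>T * A\<^sup>T)\<^sup>T"
    by (rule transpose_mult[of _ p m _ n]) (use A B Y(1) in auto)
  also have "(B\<^sup>T * A\<^sup>T)\<^sup>T = A * B" unfolding T[symmetric] by simp
  finally show ?thesis by (rule that[rotated]) (use Y(1) in simp)
qed

section \<open>The Drazin inverse\<close>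

lemma pow_mat_add:
  fixes A :: "'a :: semiring_1 mat"
  assumes A: "A \<in> carrier_mat n n"
  shows "A ^\<^sub>m (i + j) = A ^\<^sub>m i * A ^\<^sub>m j"
proof (induction j)
  case 0
  show ?case using A right_mult_one_mat[OF pow_carrier_mat[OF A, of i]] by simp
next
  case (Suc j)
  then show ?case
    using assoc_mult_mat[OF pow_carrier_mat[OF A, of i] pow_carrier_mat[OF A, of j] A] by simp
qed

lemma mult_pow_mat_commute:
  fixes A :: "'a :: semiring_1 mat"
  assumes A: "A \<in> carrier_mat n n" and C: "C \<in> carrier_mat n n" and comm: "C * A = A * C"
  shows "C * A ^\<^sub>m j = A ^\<^sub>m j * C"
proof (induction j)
  case 0
  show ?case using A C by simp
next
  case (Suc j)
  note pow = pow_carrier_mat[OF A, of j]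
  have "C * A ^\<^sub>m Suc j = A ^\<^sub>m j * C * A"
    using assoc_mult_mat[OF C pow A] Suc by simp
  also have "\<dots> = A ^\<^sub>m j * (A * C)"
    using assoc_mult_mat[OF pow C A] comm by simp
  also have "\<dots> = A ^\<^sub>m Suc j * C"
    using assoc_mult_mat[OF pow A C] by simp
  finally show ?case .
qed

lemmas pow_mat_commute = mult_pow_mat_commute[OF _ _ refl]

text \<open>The index is a least element, so its property needs a witness: the ranks of the powers
  cannot decrease strictly for ever.\<close>
lemma mat_rank_pow_mat_index:
  assumes A: "A \<in> carrier_mat n n"
  shows "mat_rank (A ^\<^sub>m (mat_index A + 1)) = mat_rank (A ^\<^sub>m mat_index A)"
  unfolding mat_index_def
proof (rule LeastI_ex, rule ccontr)
  let ?f = "\<lambda>k. mat_rank (A ^\<^sub>m k)"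
  assume no: "\<nexists>k. ?f (k + 1) = ?f k"
  have le: "?f (k + 1) \<le> ?f k" for k
    using mat_rank_mult_le_left[OF pow_carrier_mat[OF A, of k] A] by simp
  have "?f k + k \<le> ?f 0" for k
  proof (induction k)
    case (Suc k)
    have "?f (k + 1) \<noteq> ?f k" using no by blast
    with le[of k] Suc show ?case by simp
  qed simp
  from this[of "?f 0 + 1"] show False by simp
qed

text \<open>From \<open>A\<^sup>k = A\<^sup>k\<^sup>+\<^sup>1 Y\<close>, which is what the equality of ranks gives, iteration leads to
  \<open>A\<^sup>k = A\<^sup>k\<^sup>+\<^sup>j U\<close> for every \<open>j\<close>; the lemma is the case \<open>j = k + 1\<close> together with its mirror image.\<close>
lemma pow_mat_index_factors:
  assumes A: "A \<in> carrier_mat n n" and k: "k = mat_index A"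
  obtains U V where "U \<in> carrier_mat n n" "V \<in> carrier_mat n n"
    "A ^\<^sub>m k * A * A ^\<^sub>m k * U = A ^\<^sub>m k" "V * (A ^\<^sub>m k * A * A ^\<^sub>m k) = A ^\<^sub>m k"
proof -
  note pow = pow_carrier_mat[OF A]
  note assoc = assoc_mult_mat[of _ n n _ n _ n]
  have rk: "mat_rank (A ^\<^sub>m k * A) = mat_rank (A ^\<^sub>m k)"
    using mat_rank_pow_mat_index[OF A] by (simp add: k)
  obtain Y where Y: "Y \<in> carrier_mat n n" and Yk: "A ^\<^sub>m k = A ^\<^sub>m k * A * Y"
    by (rule right_factor_if_rank_mult_eq[OF pow A rk])
  obtain Z where Z: "Z \<in> carrier_mat n n" and Zk: "A ^\<^sub>m k = Z * (A * A ^\<^sub>m k)"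
    by (rule left_factor_if_rank_mult_eq[OF A pow]) (use rk pow_mat_commute[OF A A] in auto)
  have comm: "A ^\<^sub>m i * A ^\<^sub>m j = A ^\<^sub>m j * A ^\<^sub>m i" for i j
    using pow_mat_add[OF A, of i j] pow_mat_add[OF A, of j i] by (simp add: add.commute)
  have right: "\<exists>U \<in> carrier_mat n n. A ^\<^sub>m k * A ^\<^sub>m j * U = A ^\<^sub>m k" for j
  proof (induction j)
    case 0
    show ?case by (rule bexI[of _ "1\<^sub>m n"]) (use A pow in auto)
  next
    case (Suc j)
    then obtain U where U: "U \<in> carrier_mat n n" "A ^\<^sub>m k * A ^\<^sub>m j * U = A ^\<^sub>m k" by blast
    have "A ^\<^sub>m k * A ^\<^sub>m (Suc j) * (Y * U) = A ^\<^sub>m k * A ^\<^sub>m j * A * (Y * U)"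
      using A pow by (simp add: assoc)
    also have "\<dots> = A ^\<^sub>m j * A ^\<^sub>m k * A * (Y * U)" by (simp only: comm)
    also have "\<dots> = A ^\<^sub>m j * (A ^\<^sub>m k * A * Y) * U"
      using A pow Y U(1) by (simp add: assoc mult_carrier_mat[of _ n n _ n])
    also have "\<dots> = A ^\<^sub>m k * A ^\<^sub>m j * U" by (simp only: Yk[symmetric] comm)
    finally show ?case using U Y by (metis mult_carrier_mat)
  qed
  have left: "\<exists>V \<in> carrier_mat n n. V * (A ^\<^sub>m j * A ^\<^sub>m k) = A ^\<^sub>m k" for j
  proof (induction j)
    case 0
    show ?case by (rule bexI[of _ "1\<^sub>m n"]) (use A pow in auto)
  next
    case (Suc j)
    then obtain V where V: "V \<in> carrier_mat n n" "V * (A ^\<^sub>m j * A ^\<^sub>m k) = A ^\<^sub>m k" by blast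
    have "V * Z * (A ^\<^sub>m (Suc j) * A ^\<^sub>m k) = V * Z * (A * (A ^\<^sub>m j * A ^\<^sub>m k))"
      using A pow pow_mat_commute[OF A A, of j] by (simp add: assoc[symmetric])
    also have "\<dots> = V * Z * (A * (A ^\<^sub>m k * A ^\<^sub>m j))" by (simp only: comm)
    also have "\<dots> = V * ((Z * (A * A ^\<^sub>m k)) * A ^\<^sub>m j)"
      using A pow Z V(1) by (simp add: assoc mult_carrier_mat[of _ n n _ n])
    also have "\<dots> = V * (A ^\<^sub>m j * A ^\<^sub>m k)" by (simp only: Zk[symmetric] comm)
    finally show ?case using V Z by (metis mult_carrier_mat)
  qed
  have eq: "A ^\<^sub>m k * A * A ^\<^sub>m k = A ^\<^sub>m k * A ^\<^sub>m (Suc k)"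
    "A ^\<^sub>m k * A * A ^\<^sub>m k = A ^\<^sub>m (Suc k) * A ^\<^sub>m k"
    using A pow pow_mat_commute[OF A A, of k] by (simp_all add: assoc)
  from right[of "Suc k"] left[of "Suc k"] that show ?thesis
    unfolding eq(1)[symmetric] eq(2)[symmetric] by blast
qed

text \<open>For \<open>B = A\<^sup>k\<close> the Drazin inverse is \<open>B * U\<close>. Inserting \<open>B = V * (B * A * B)\<close> on the left shows
  that it equals \<open>V * B\<close>; this second form gives that it commutes with \<open>A\<close>.\<close>
lemma drazin_equations_if_factors:
  assumes A: "A \<in> carrier_mat n n" and U: "U \<in> carrier_mat n n" and V: "V \<in> carrier_mat n n"
    and B: "B \<in> carrier_mat n n" and comm: "A * B = B * A"
    and BU: "B * A * B * U = B" and VB: "V * (B * A * B) = B"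
  shows "(B * U) * A * (B * U) = B * U" "A * (B * U) = (B * U) * A" "B * A * (B * U) = B"
proof -
  note assoc = assoc_mult_mat[of _ n n _ n _ n] mult_carrier_mat[of _ n n _ n]
  have X: "B * U = V * B"
  proof -
    have "B * U = V * (B * A * B) * U" by (simp only: VB)
    also have "\<dots> = V * (B * A * B * U)" using A B U V by (simp add: assoc)
    finally show ?thesis by (simp only: BU)
  qed
  show AX: "A * (B * U) = (B * U) * A"
  proof -
    have "(B * U) * A = V * (B * A)" unfolding X using A B V by (simp add: assoc)
    also have "\<dots> = V * A * B" unfolding comm[symmetric] using A B V by (simp add: assoc)
    also have "\<dots> = V * A * (B * A * B * U)" by (simp only: BU)
    also have "\<dots> = V * (A * B * A * B) * U" using A B U V by (simp add: assoc)
    also have "\<dots> = V * (B * A * A * B) * U" by (simp only: comm)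
    also have "\<dots> = V * (B * A * (A * B)) * U" using A B U V by (simp add: assoc)
    also have "\<dots> = V * (B * A * B) * A * U"
      unfolding comm using A B U V by (simp add: assoc)
    also have "\<dots> = (A * B) * U" by (simp only: VB comm)
    finally show ?thesis using A B U by (simp add: assoc)
  qed
  show "B * A * (B * U) = B" using BU A B U by (simp add: assoc)
  have "(B * U) * A * (B * U) = V * (B * A * B) * U"
    unfolding X using A B U V X by (simp add: assoc)
  then show "(B * U) * A * (B * U) = B * U" by (simp only: VB)
qed

lemma ex_drazin_inverse:
  assumes A: "A \<in> carrier_mat n n"
  obtains X where "is_drazin_inverse A X"
proof -
  define k where "k = mat_index A"
  obtain U V where UV: "U \<in> carrier_mat n n" "V \<in> carrier_mat n n"
    and fac: "A ^\<^sub>m k * A * A ^\<^sub>m k * U = A ^\<^sub>m k" "V * (A ^\<^sub>m k * A * A ^\<^sub>m k) = A ^\<^sub>m k"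
    by (rule pow_mat_index_factors[OF A k_def])
  have "is_drazin_inverse A (A ^\<^sub>m k * U)"
    unfolding is_drazin_inverse_def k_def[symmetric]
    using drazin_equations_if_factors[OF A UV pow_carrier_mat[OF A] pow_mat_commute[OF A A] fac]
      A UV mult_carrier_mat[OF pow_carrier_mat[OF A] UV(1), of k] by simp
  then show ?thesis by (rule that)
qed

text \<open>The idempotent \<open>X * A\<close> equals all its powers \<open>X\<^sup>j A\<^sup>j\<close>, because \<open>X\<close> and \<open>A\<close> commute, so any power
  of \<open>A\<close> can be split off on either side.\<close>
lemma drazin_projection_factors:
  assumes A: "A \<in> carrier_mat n n" and X: "X \<in> carrier_mat n n"
    and XAX: "X * A * X = X" and comm: "A * X = X * A"
  shows "\<exists>W \<in> carrier_mat n n. X * A = A ^\<^sub>m j * W \<and> X * A = W * A ^\<^sub>m j"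
proof (induction j)
  case 0
  show ?case by (rule bexI[of _ "X * A"]) (use A X in auto)
next
  case (Suc j)
  note assoc = assoc_mult_mat[of _ n n _ n _ n] mult_carrier_mat[of _ n n _ n]
  note pow = pow_carrier_mat[OF A, of j]
  obtain W where W: "W \<in> carrier_mat n n" "X * A = A ^\<^sub>m j * W" "X * A = W * A ^\<^sub>m j"
    using Suc by blast
  have idem: "X * A * (X * A) = X * A"
  proof -
    have "X * A * (X * A) = X * A * X * A" using A X by (simp add: assoc)
    then show ?thesis by (simp only: XAX)
  qed
  have AXA: "A * X * A = A * (A * X)"
    using assoc_mult_mat[OF A X A] comm by simp
  \<comment> \<open>\<open>A * X\<close> commutes with \<open>A\<close>, hence with its powers; one more factor \<open>A\<close> is gained from \<open>X * A = (X * A) * (X * A)\<close>\<close>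
  have AjX: "A * X * A ^\<^sub>m j = A ^\<^sub>m j * (A * X)"
    by (rule mult_pow_mat_commute[OF A mult_carrier_mat[OF A X] AXA])
  have "X * A = (A * X) * (A ^\<^sub>m j * W)" using idem by (simp only: comm W(2)[symmetric])
  also have "\<dots> = (A * X * A ^\<^sub>m j) * W" using A X W(1) pow by (simp add: assoc)
  also have "\<dots> = A ^\<^sub>m Suc j * (X * W)"
    unfolding AjX using A X W(1) pow by (simp add: assoc)
  finally have 1: "X * A = A ^\<^sub>m Suc j * (X * W)" .
  have "X * A = (W * A ^\<^sub>m j) * (A * X)" using idem by (simp only: comm W(3)[symmetric])
  also have "\<dots> = (W * A ^\<^sub>m j) * X * A" using A X W(1) pow unfolding comm by (simp add: assoc)
  also have "\<dots> = X * A * X * A" by (simp only: W(3))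
  also have "\<dots> = X * (W * A ^\<^sub>m j) * A"
    unfolding W(3)[symmetric] using A X comm by (simp add: assoc)
  also have "\<dots> = (X * W) * A ^\<^sub>m Suc j" using A X W(1) pow by (simp add: assoc)
  finally have 2: "X * A = (X * W) * A ^\<^sub>m Suc j" .
  show ?case using 1 2 X W(1) by (metis mult_carrier_mat)
qed

text \<open>Both \<open>X * A\<close> and \<open>Y * A\<close> are divisible by \<open>A\<^sup>k\<close> on both sides, and both fix \<open>A\<^sup>k\<close>; hence their
  product equals each of them. An outer inverse that commutes with \<open>A\<close> is determined by this
  idempotent.\<close>
lemma drazin_inverse_unique:
  assumes A: "A \<in> carrier_mat n n"
    and "is_drazin_inverse A X" and "is_drazin_inverse A Y"
  shows "X = Y"
proof -
  define k where "k = mat_index A"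
  note assoc = assoc_mult_mat[of _ n n _ n _ n] mult_carrier_mat[of _ n n _ n]
  have X: "X \<in> carrier_mat n n" "X * A * X = X" "A * X = X * A" "A ^\<^sub>m k * A * X = A ^\<^sub>m k"
    and Y: "Y \<in> carrier_mat n n" "Y * A * Y = Y" "A * Y = Y * A" "A ^\<^sub>m k * A * Y = A ^\<^sub>m k"
    using assms unfolding is_drazin_inverse_def k_def by auto
  note pow = pow_carrier_mat[OF A, of k]
  obtain V where V: "V \<in> carrier_mat n n" "Y * A = V * A ^\<^sub>m k"
    using drazin_projection_factors[OF A Y(1-3)] by blast
  obtain W where W: "W \<in> carrier_mat n n" "X * A = A ^\<^sub>m k * W"
    using drazin_projection_factors[OF A X(1-3)] by blast
  have "Y * A = V * (A ^\<^sub>m k * A * X)" by (simp only: X(4) V(2))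
  also have "\<dots> = (V * A ^\<^sub>m k) * (A * X)" using A X(1) V(1) pow by (simp add: assoc)
  also have "\<dots> = (A * Y) * (X * A)" by (simp only: V(2)[symmetric] X(3) Y(3))
  also have "\<dots> = (A * Y * A ^\<^sub>m k) * W" unfolding W(2) using A Y(1) W(1) pow by (simp add: assoc)
  also have "A * Y * A ^\<^sub>m k = A ^\<^sub>m k"
  proof -
    have "A * Y * A = A * (A * Y)"
      using assoc_mult_mat[OF A Y(1) A] Y(3) by simp
    then have "A * Y * A ^\<^sub>m k = A ^\<^sub>m k * (A * Y)"
      by (rule mult_pow_mat_commute[OF A mult_carrier_mat[OF A Y(1)]])
    also have "\<dots> = A ^\<^sub>m k * A * Y"
      by (rule assoc_mult_mat[symmetric]) (use A Y(1) pow in auto)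
    finally show ?thesis by (simp only: Y(4))
  qed
  also have "A ^\<^sub>m k * W = X * A" by (simp only: W(2))
  finally have eq: "Y * A = X * A" .
  have "X = (X * A) * X" by (simp only: X(2))
  also have "\<dots> = Y * (A * X)" unfolding eq[symmetric] using A X(1) Y(1) by (simp add: assoc)
  also have "A * X = A * Y" by (simp only: X(3) Y(3) eq)
  also have "Y * (A * Y) = Y * A * Y" using A Y(1) by (simp add: assoc)
  finally show ?thesis by (simp only: Y(2))
qed

lemma drazin_inverse_is_drazin_inverse:
  assumes "A \<in> carrier_mat n n"
  shows "is_drazin_inverse A (drazin_inverse A)"
  unfolding drazin_inverse_def
  by (rule theI', rule ex_drazin_inverse[OF assms]) (blast intro: drazin_inverse_unique[OF assms])

section \<open>The Minkowski inverse\<close>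

lemma mat_adjoint_carrier:
  "A \<in> carrier_mat m n \<Longrightarrow> mat_adjoint A \<in> carrier_mat n m"
  unfolding mat_adjoint_def using mat_of_rows_carrier(1)[of m "map conjugate (cols A)"] by auto

lemma minkowski_adjoint_carrier [simp]:
  assumes "A \<in> carrier_mat n n"
  shows "minkowski_adjoint A \<in> carrier_mat n n"
  using assms mat_adjoint_carrier[OF assms]
  by (auto simp: minkowski_adjoint_def minkowski_metric_def)

lemma mat_adjoint_index:
  assumes "A \<in> carrier_mat m n" "i < n" "j < m"
  shows "mat_adjoint A $$ (i, j) = conjugate (A $$ (j, i))"
  using assms by (simp add: mat_adjoint_def mat_of_rows_index)

definition minkowski_sign :: "nat \<Rightarrow> complex" where
  "minkowski_sign i = (if i = 0 then 1 else -1)"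

lemma minkowski_sign_square [simp]: "minkowski_sign i * (minkowski_sign i * z) = z"
  by (simp add: minkowski_sign_def)

lemma cnj_minkowski_sign [simp]: "cnj (minkowski_sign i) = minkowski_sign i"
  by (simp add: minkowski_sign_def)

text \<open>Entrywise, the Minkowski adjoint is the conjugate transpose with the signs of both indices. As
  the signs square to one, its algebraic laws can be read off.\<close>
lemma minkowski_adjoint_index:
  assumes A: "A \<in> carrier_mat n n" and i: "i < n" and j: "j < n"
  shows "minkowski_adjoint A $$ (i, j) = minkowski_sign i * minkowski_sign j * cnj (A $$ (j, i))"
proof -
  let ?G = "minkowski_metric n"
  have G: "?G \<in> carrier_mat n n" by (simp add: minkowski_metric_def)
  have Gij: "?G $$ (a, b) = (if a = b then minkowski_sign a else 0)" if "a < n" "b < n" for a b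
    using that by (simp add: minkowski_metric_def minkowski_sign_def)
  note adj = mat_adjoint_carrier[OF A]
  have GA: "(?G * mat_adjoint A) $$ (i, b) = minkowski_sign i * cnj (A $$ (b, i))" if b: "b < n" for b
  proof -
    have "(?G * mat_adjoint A) $$ (i, b) = (\<Sum>a = 0..<n. ?G $$ (i, a) * mat_adjoint A $$ (a, b))"
      using G adj i b by (simp add: scalar_prod_def)
    also have "\<dots> = (\<Sum>a = 0..<n. if i = a then minkowski_sign i * cnj (A $$ (b, i)) else 0)"
      by (rule sum.cong) (use Gij mat_adjoint_index[OF A] i b in auto)
    finally show ?thesis using i by simp
  qed
  have "(M * ?G) $$ (i, j) = (\<Sum>b = 0..<n. M $$ (i, b) * ?G $$ (b, j))"
    if "M \<in> carrier_mat n n" for M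
    using that G i j by (simp add: scalar_prod_def)
  from this[OF mult_carrier_mat[OF G adj]]
  have "minkowski_adjoint A $$ (i, j) = (\<Sum>b = 0..<n. (?G * mat_adjoint A) $$ (i, b) * ?G $$ (b, j))"
    using carrier_matD(1)[OF A] by (simp only: minkowski_adjoint_def)
  also have "\<dots> = (\<Sum>b = 0..<n. if b = j then minkowski_sign i * minkowski_sign j * cnj (A $$ (j, i)) else 0)"
    by (rule sum.cong) (use Gij GA j in auto)
  finally show ?thesis using j by simp
qed

lemma minkowski_adjoint_invol:
  assumes "A \<in> carrier_mat n n"
  shows "minkowski_adjoint (minkowski_adjoint A) = A"
proof (rule eq_matI)
  fix i j assume "i < dim_row A" "j < dim_col A"
  then show "minkowski_adjoint (minkowski_adjoint A) $$ (i, j) = A $$ (i, j)"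
    using assms minkowski_adjoint_carrier[OF assms]
    by (simp add: minkowski_adjoint_index[of _ n] mult.assoc mult.left_commute)
next
  have "minkowski_adjoint (minkowski_adjoint A) \<in> carrier_mat n n"
    using assms minkowski_adjoint_carrier by blast
  from carrier_matD[OF this] show "dim_row (minkowski_adjoint (minkowski_adjoint A)) = dim_row A"
    "dim_col (minkowski_adjoint (minkowski_adjoint A)) = dim_col A"
    using assms by auto
qed

lemma minkowski_adjoint_mult:
  assumes A: "A \<in> carrier_mat n n" and B: "B \<in> carrier_mat n n"
  shows "minkowski_adjoint (A * B) = minkowski_adjoint B * minkowski_adjoint A"
proof (rule eq_matI)
  note carr = minkowski_adjoint_carrier[OF A] minkowski_adjoint_carrier[OF B]
    minkowski_adjoint_carrier[OF mult_carrier_mat[OF A B]]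
  fix i j
  assume "i < dim_row (minkowski_adjoint B * minkowski_adjoint A)"
    "j < dim_col (minkowski_adjoint B * minkowski_adjoint A)"
  then have i: "i < n" and j: "j < n" using carr by auto
  have "minkowski_adjoint (A * B) $$ (i, j)
      = minkowski_sign i * minkowski_sign j * cnj (\<Sum>b = 0..<n. A $$ (j, b) * B $$ (b, i))"
    using A B i j minkowski_adjoint_index[OF mult_carrier_mat[OF A B] i j]
    by (simp add: scalar_prod_def)
  also have "\<dots> = (\<Sum>b = 0..<n. minkowski_adjoint B $$ (i, b) * minkowski_adjoint A $$ (b, j))"
    unfolding cnj_sum sum_distrib_left
    by (rule sum.cong)
      (use minkowski_adjoint_index[OF A _ j] minkowski_adjoint_index[OF B i] in \<open>auto simp: mult_ac\<close>)
  also have "\<dots> = (minkowski_adjoint B * minkowski_adjoint A) $$ (i, j)"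
    using carr i j by (simp add: scalar_prod_def)
  finally show "minkowski_adjoint (A * B) $$ (i, j) = (minkowski_adjoint B * minkowski_adjoint A) $$ (i, j)" .
next
  note carr = minkowski_adjoint_carrier[OF A] minkowski_adjoint_carrier[OF B]
    minkowski_adjoint_carrier[OF mult_carrier_mat[OF A B]]
  then show "dim_row (minkowski_adjoint (A * B)) = dim_row (minkowski_adjoint B * minkowski_adjoint A)"
    "dim_col (minkowski_adjoint (A * B)) = dim_col (minkowski_adjoint B * minkowski_adjoint A)"
    by auto
qed

text \<open>As for the Moore-Penrose inverse: \<open>A * Y * A = A\<close> gives \<open>A * X = (A * Y) * (A * X)\<close>, and taking
  adjoints exchanges the two factors, so \<open>A * X = (A * X) * (A * Y) = A * Y\<close>.\<close>
lemma minkowski_inverse_unique: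
  assumes A: "A \<in> carrier_mat n n"
    and "is_minkowski_inverse A X" and "is_minkowski_inverse A Y"
  shows "X = Y"
proof -
  note assoc = assoc_mult_mat[of _ n n _ n _ n] mult_carrier_mat[of _ n n _ n]
  have X: "X \<in> carrier_mat n n" "A * X * A = A" "X * A * X = X"
      "minkowski_adjoint (A * X) = A * X" "minkowski_adjoint (X * A) = X * A"
    and Y: "Y \<in> carrier_mat n n" "A * Y * A = A" "Y * A * Y = Y"
      "minkowski_adjoint (A * Y) = A * Y" "minkowski_adjoint (Y * A) = Y * A"
    using assms unfolding is_minkowski_inverse_def by auto
  note carr = mult_carrier_mat[OF A X(1)] mult_carrier_mat[OF A Y(1)]
    mult_carrier_mat[OF X(1) A] mult_carrier_mat[OF Y(1) A]
  have "A * X = A * Y * A * X" by (simp only: Y(2))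
  also have "\<dots> = (A * Y) * (A * X)" using A X(1) Y(1) by (simp add: assoc)
  finally have "minkowski_adjoint (A * X) = minkowski_adjoint ((A * Y) * (A * X))" by (rule arg_cong)
  also have "\<dots> = (A * X) * (A * Y)" by (simp only: minkowski_adjoint_mult[OF carr(2,1)] X(4) Y(4))
  also have "\<dots> = (A * X * A) * Y" using A X(1) Y(1) by (simp add: assoc)
  finally have AX: "A * X = A * Y" by (simp only: X(2,4))
  have "X * A = X * (A * Y * A)" by (simp only: Y(2))
  also have "\<dots> = (X * A) * (Y * A)" using A X(1) Y(1) by (simp add: assoc)
  finally have "minkowski_adjoint (X * A) = minkowski_adjoint ((X * A) * (Y * A))" by (rule arg_cong)
  also have "\<dots> = (Y * A) * (X * A)" by (simp only: minkowski_adjoint_mult[OF carr(3,4)] X(5) Y(5))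
  also have "\<dots> = Y * (A * X * A)" using A X(1) Y(1) by (simp add: assoc)
  finally have XA: "X * A = Y * A" by (simp only: X(2,5))
  have "X = (X * A) * X" by (simp only: X(3))
  also have "\<dots> = Y * (A * X)" unfolding XA using A X(1) Y(1) by (simp add: assoc)
  also have "\<dots> = Y * A * Y" unfolding AX using A Y(1) by (simp add: assoc)
  finally show ?thesis by (simp only: Y(3))
qed

text \<open>The adjoint \<open>W\<close> of \<open>Z\<close> satisfies \<open>A * W * A = A\<close> with \<open>A * W\<close> self-adjoint, and the adjoint \<open>V\<close> of
  \<open>Y\<close> satisfies \<open>A * V * A = A\<close> with \<open>V * A\<close> self-adjoint. The product \<open>V * A * W\<close> inherits both.\<close>
lemma is_minkowski_inverse_if_factors:
  assumes A: "A \<in> carrier_mat n n" and Y: "Y \<in> carrier_mat n n" and Z: "Z \<in> carrier_mat n n"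
    and AY: "A = A * minkowski_adjoint A * Y" and ZA: "A = Z * (minkowski_adjoint A * A)"
  shows "is_minkowski_inverse A (minkowski_adjoint Y * A * minkowski_adjoint Z)"
proof -
  note assoc = assoc_mult_mat[of _ n n _ n _ n] mult_carrier_mat[of _ n n _ n]
  define A' V W where "A' = minkowski_adjoint A"
    and "V = minkowski_adjoint Y" and "W = minkowski_adjoint Z"
  have carr: "A' \<in> carrier_mat n n" "V \<in> carrier_mat n n" "W \<in> carrier_mat n n"
    using A Y Z by (simp_all add: A'_def V_def W_def)
  have adj: "minkowski_adjoint A' = A" "minkowski_adjoint V = Y" "minkowski_adjoint W = Z"
    "minkowski_adjoint A = A'"
    using A Y Z by (simp_all add: A'_def V_def W_def minkowski_adjoint_invol)
  have AW: "minkowski_adjoint (A * W) = Z * A'"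
    using minkowski_adjoint_mult[OF A carr(3)] by (simp only: adj)
  have VA: "minkowski_adjoint (V * A) = A' * Y"
    using minkowski_adjoint_mult[OF carr(2) A] by (simp only: adj)
  have AY': "A * A' * Y = A" and ZA': "Z * (A' * A) = A" using AY ZA by (simp_all add: A'_def)
  \<comment> \<open>\<open>V\<close> and \<open>W\<close> enter by taking adjoints in the two factorizations of \<open>A\<close>\<close>
  have "minkowski_adjoint (A * (A' * Y)) = V * A * A'"
    using minkowski_adjoint_mult[OF A mult_carrier_mat[OF carr(1) Y]] minkowski_adjoint_mult[OF carr(1) Y]
    by (simp only: adj V_def[symmetric])
  moreover have "A * (A' * Y) = A" using AY' A carr Y by (simp add: assoc)
  ultimately have A'1: "V * A * A' = A'" by (simp only: adj)
  have "minkowski_adjoint (Z * (A' * A)) = A' * A * W"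
    using minkowski_adjoint_mult[OF Z mult_carrier_mat[OF carr(1) A]] minkowski_adjoint_mult[OF carr(1) A]
    by (simp only: adj W_def[symmetric])
  then have A'2: "A' * A * W = A'" by (simp only: ZA' adj)
  \<comment> \<open>the self-adjointness of \<open>A * W\<close>, as its adjoint is \<open>Z * A\<^sup>~\<close>\<close>
  have sAW: "Z * A' = A * W"
  proof -
    have "Z * A' = Z * (A' * A * W)" by (simp only: A'2)
    also have "\<dots> = Z * (A' * A) * W" using A carr Z by (simp add: assoc)
    finally show ?thesis by (simp only: ZA')
  qed
  have sVA: "A' * Y = V * A"
  proof -
    have "A' * Y = V * A * A' * Y" by (simp only: A'1)
    also have "\<dots> = V * (A * A' * Y)" using A carr Y by (simp add: assoc)
    finally show ?thesis by (simp only: AY')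
  qed
  have AWA: "A * W * A = A"
    unfolding sAW[symmetric] using ZA' A carr Z by (simp add: assoc)
  have AVA: "A * (V * A) = A"
    unfolding sVA[symmetric] using AY' A carr Y by (simp add: assoc)
  let ?X = "V * A * W"
  have X: "?X \<in> carrier_mat n n" using A carr by simp
  have AX: "A * ?X = A * W"
  proof -
    have "A * ?X = A * (V * A) * W" using A carr by (simp add: assoc)
    then show ?thesis by (simp only: AVA)
  qed
  have XA: "?X * A = V * A"
  proof -
    have "?X * A = V * (A * W * A)" using A carr by (simp add: assoc)
    then show ?thesis by (simp only: AWA)
  qed
  have "?X * A * ?X = V * (A * (V * A)) * W" unfolding XA using A carr by (simp add: assoc)
  then have "?X * A * ?X = ?X" by (simp only: AVA)
  moreover have "dim_row A = n" using A by simp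
  ultimately show ?thesis
    unfolding is_minkowski_inverse_def V_def[symmetric] W_def[symmetric]
    using X by (simp add: AX XA AW VA sAW sVA AWA del: carrier_matD)
qed

text \<open>The rank of \<open>A\<^sup>~ A A\<^sup>~\<close> bounds those of \<open>A\<^sup>~ A\<close> and \<open>A A\<^sup>~\<close> from below, so all of them equal the rank of
  \<open>A\<close>, and \<open>A\<close> factors through \<open>A A\<^sup>~\<close> on the left and \<open>A\<^sup>~ A\<close> on the right.\<close>
lemma minkowski_inverse_is_minkowski_inverse:
  assumes A: "A \<in> carrier_mat n n"
    and rk: "mat_rank (minkowski_adjoint A * A * minkowski_adjoint A) = mat_rank A"
  shows "is_minkowski_inverse A (minkowski_inverse A)"
proof -
  let ?B = "minkowski_adjoint A"
  have B: "?B \<in> carrier_mat n n" using A by simp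
  note BA = mult_carrier_mat[OF B A] and AB = mult_carrier_mat[OF A B]
  have "mat_rank A \<le> mat_rank (?B * A)"
    using mat_rank_mult_le_left[OF BA B] rk by simp
  then have rBA: "mat_rank (?B * A) = mat_rank A"
    using mat_rank_mult_le_right[OF B A] by simp
  have "mat_rank A \<le> mat_rank (A * ?B)"
    using mat_rank_mult_le_right[OF B AB] rk assoc_mult_mat[OF B A B] by simp
  then have rAB: "mat_rank (A * ?B) = mat_rank A"
    using mat_rank_mult_le_left[OF A B] by simp
  obtain Y where "Y \<in> carrier_mat n n" "A = A * ?B * Y"
    by (rule right_factor_if_rank_mult_eq[OF A B rAB])
  moreover obtain Z where "Z \<in> carrier_mat n n" "A = Z * (?B * A)"
    by (rule left_factor_if_rank_mult_eq[OF B A rBA])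
  ultimately have "\<exists>X. is_minkowski_inverse A X"
    using is_minkowski_inverse_if_factors[OF A] by blast
  then show ?thesis
    unfolding minkowski_inverse_def
    by (rule theI'[OF ex_ex1I]) (rule minkowski_inverse_unique[OF A])
qed

section \<open>Projectors and outer inverses with prescribed range and null space\<close>

lemma subspace_mat_range:
  assumes "A \<in> carrier_mat n m"
  shows "VectorSpace.subspace class_ring (mat_range A) (module_vec TYPE(complex) n)"
proof -
  interpret vec_space "TYPE(complex)" n .
  have "set (cols A) \<subseteq> carrier_vec n" using assms cols_dim[of A] by auto
  then show ?thesis
    using span_is_subspace assms by (simp add: mat_range_col_space col_space_def)
qed

lemma subspace_mat_kernel:
  fixes A :: "complex mat"
  assumes A: "A \<in> carrier_mat m n"
  shows "VectorSpace.subspace class_ring (mat_kernel A) (module_vec TYPE(complex) n)"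
proof -
  interpret vec_space "TYPE(complex)" n .
  have "LinearCombinations.submodule class_ring (mat_kernel A) V"
    by unfold_locales
      (use A mult_add_distrib_mat_vec[OF A] mult_mat_vec[OF A] mat_kernel[OF A] in auto)
  then show ?thesis unfolding VectorSpace.subspace_def using vec_vs by simp
qed

lemma mat_range_eq_if_mutual_factors:
  assumes "P \<in> carrier_mat m p" "Q \<in> carrier_mat m q" "U \<in> carrier_mat q p" "V \<in> carrier_mat p q"
    and "P = Q * U" "Q = P * V"
  shows "mat_range P = mat_range Q"
  using assms mat_range_mult_subset by (metis subset_antisym)

lemma mat_kernel_eq_if_mutual_factors:
  fixes P Q :: "complex mat"
  assumes "P \<in> carrier_mat p m" "Q \<in> carrier_mat q m" "U \<in> carrier_mat p q" "V \<in> carrier_mat q p"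
    and "P = U * Q" "Q = V * P"
  shows "mat_kernel P = mat_kernel Q"
  using assms mat_kernel_mult_subset by (metis subset_antisym)

text \<open>Every vector \<open>v\<close> splits as \<open>E v + (v - E v)\<close>, and \<open>E\<close> fixes its range and annihilates its null
  space.\<close>
lemma idempotent_projector:
  assumes E: "E \<in> carrier_mat n n" and idem: "E * E = E"
  shows "complementary_subspaces n (mat_range E) (mat_kernel E)"
    and "projector n (mat_range E) (mat_kernel E) = E"
proof -
  have EE: "E *\<^sub>v (E *\<^sub>v v) = E *\<^sub>v v" if "v \<in> carrier_vec n" for v
    using assoc_mult_mat_vec[OF E E that] by (simp only: idem)
  have fixed: "E *\<^sub>v s = s" "s \<in> carrier_vec n" if "s \<in> mat_range E" for s
    using that EE E unfolding mat_range_def by auto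
  have ker: "E *\<^sub>v t = 0\<^sub>v n" "t \<in> carrier_vec n" if "t \<in> mat_kernel E" for t
    using mat_kernelD[OF E that] by auto
  have split: "\<exists>s\<in>mat_range E. \<exists>t\<in>mat_kernel E. v = s + t" if v: "v \<in> carrier_vec n" for v
  proof (intro bexI)
    have Ev: "E *\<^sub>v v \<in> carrier_vec n" using E v by simp
    show "v = E *\<^sub>v v + (v - E *\<^sub>v v)" by (rule eq_vecI) (use E v Ev in auto)
    show "E *\<^sub>v v \<in> mat_range E" using E v unfolding mat_range_def by auto
    have "E *\<^sub>v (v - E *\<^sub>v v) = 0\<^sub>v n"
      using mult_minus_distrib_mat_vec[OF E v Ev] EE[OF v] Ev by simp
    then show "v - E *\<^sub>v v \<in> mat_kernel E"
      using mat_kernelI[OF E] v Ev by simp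
  qed
  have "mat_range E \<inter> mat_kernel E = {0\<^sub>v n}"
  proof
    show "mat_range E \<inter> mat_kernel E \<subseteq> {0\<^sub>v n}"
    proof
      fix x assume "x \<in> mat_range E \<inter> mat_kernel E"
      then have "E *\<^sub>v x = x" "E *\<^sub>v x = 0\<^sub>v n" using fixed ker by blast+
      then show "x \<in> {0\<^sub>v n}" by simp
    qed
    have "E *\<^sub>v 0\<^sub>v n = 0\<^sub>v n"
      by (rule eq_vecI) (use E in \<open>auto simp: scalar_prod_def\<close>)
    moreover from this have "0\<^sub>v n \<in> mat_range E"
      using E unfolding mat_range_def by (auto intro!: exI[of _ "0\<^sub>v n"])
    ultimately show "{0\<^sub>v n} \<subseteq> mat_range E \<inter> mat_kernel E"
      using mat_kernelI[OF E, of "0\<^sub>v n"] by simp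
  qed
  moreover have "{s + t | s t. s \<in> mat_range E \<and> t \<in> mat_kernel E} = carrier_vec n"
    using split fixed(2) ker(2) by fastforce
  ultimately show "complementary_subspaces n (mat_range E) (mat_kernel E)"
    unfolding complementary_subspaces_def
    using subspace_mat_range[OF E] subspace_mat_kernel[OF E] by blast
  have proj: "E *\<^sub>v (s + t) = s" if "s \<in> mat_range E" "t \<in> mat_kernel E" for s t
    using mult_add_distrib_mat_vec[OF E fixed(2)[OF that(1)] ker(2)[OF that(2)]]
      fixed[OF that(1)] ker[OF that(2)] by simp
  show "projector n (mat_range E) (mat_kernel E) = E"
    unfolding projector_def
  proof (rule the_equality)
    show "E \<in> carrier_mat n n \<and> (\<forall>s\<in>mat_range E. \<forall>t\<in>mat_kernel E. E *\<^sub>v (s + t) = s)"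
      using E proj by blast
    fix P assume P: "P \<in> carrier_mat n n \<and> (\<forall>s\<in>mat_range E. \<forall>t\<in>mat_kernel E. P *\<^sub>v (s + t) = s)"
    show "P = E"
    proof (rule eq_mat_if_mult_vec_eq[of _ n n])
      fix v :: "complex vec" assume "v \<in> carrier_vec n"
      then obtain s t where "s \<in> mat_range E" "t \<in> mat_kernel E" "v = s + t" using split by blast
      then show "P *\<^sub>v v = E *\<^sub>v v" using P proj by metis
    qed (use P E in auto)
  qed
qed

text \<open>By the inclusion of ranges, \<open>Y * A\<close> fixes \<open>X\<close>. Every \<open>v - A X v\<close> lies in the null space of \<open>X\<close>, hence in
  that of \<open>Y\<close>, so \<open>Y\<close> equals \<open>Y * A * X\<close> as well.\<close>
lemma outer_inverse_unique:
  assumes A: "A \<in> carrier_mat m n"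
    and X: "is_outer_inverse A X" and Y: "is_outer_inverse A Y"
    and ran: "mat_range X \<subseteq> mat_range Y" and ker: "mat_kernel X \<subseteq> mat_kernel Y"
  shows "X = Y"
proof -
  have cX: "X \<in> carrier_mat n m" and XAX: "X * A * X = X"
    and cY: "Y \<in> carrier_mat n m" and YAY: "Y * A * Y = Y"
    using A X Y unfolding is_outer_inverse_def by auto
  obtain U where U: "U \<in> carrier_mat m m" "X = Y * U"
    using factor_if_mat_range_subset[OF cY cX ran] .
  have "Y * A * X = Y * A * Y * U"
    unfolding U(2) by (rule assoc_mult_mat[symmetric, of _ n n _ m _ m]) (use A cY U(1) in auto)
  then have YAX: "Y * A * X = X" by (simp only: YAY U(2)[symmetric])
  have "Y = Y * A * X"
  proof (rule eq_mat_if_mult_vec_eq[OF cY])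
    show "Y * A * X \<in> carrier_mat n m" using A cX cY by simp
    fix v :: "complex vec" assume v: "v \<in> carrier_vec m"
    let ?w = "A *\<^sub>v (X *\<^sub>v v)"
    have w: "?w \<in> carrier_vec m" using A cX v by simp
    have XA: "X * A \<in> carrier_mat n n" and YA: "Y * A \<in> carrier_mat n n" using A cX cY by simp_all
    have Xv: "X *\<^sub>v v \<in> carrier_vec n" using cX v by simp
    have "X *\<^sub>v ?w = X *\<^sub>v v"
      using assoc_mult_mat_vec[OF cX A Xv] assoc_mult_mat_vec[OF XA cX v] by (simp only: XAX)
    then have "X *\<^sub>v (v - ?w) = 0\<^sub>v n"
      using mult_minus_distrib_mat_vec[OF cX v w] Xv by simp
    then have "v - ?w \<in> mat_kernel Y"
      using mat_kernelI[OF cX, of "v - ?w"] v w ker by auto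
    then have ker0: "Y *\<^sub>v (v - ?w) = 0\<^sub>v n" using mat_kernelD(2)[OF cY] by blast
    have "v = (v - ?w) + ?w" by (rule eq_vecI) (use v w A in auto)
    then have "Y *\<^sub>v v = Y *\<^sub>v ((v - ?w) + ?w)" by (rule arg_cong[of _ _ "(*\<^sub>v) Y"])
    also have "\<dots> = Y *\<^sub>v ?w"
      using mult_add_distrib_mat_vec[OF cY minus_carrier_vec[OF v w] w] ker0 cY w by simp
    also have "\<dots> = (Y * A * X) *\<^sub>v v"
      using assoc_mult_mat_vec[OF cY A Xv] assoc_mult_mat_vec[OF YA cX v] by simp
    finally show "Y *\<^sub>v v = (Y * A * X) *\<^sub>v v" .
  qed
  then show ?thesis using YAX by simp
qed

section \<open>Range, null space and projectors of the m-DMP inverse\<close>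

theorem theorem3p8:
  fixes A :: "complex mat" and n k :: nat
  assumes "A \<in> carrier_mat n n"
    and "mat_index A = k"
    and "mat_rank (minkowski_adjoint A * A * minkowski_adjoint A) = mat_rank A"
  shows
    "mat_rank (m_DMP_inverse A) = mat_rank (A ^\<^sub>m k)
     \<and>
     (mat_range (m_DMP_inverse A) = mat_range (A ^\<^sub>m k) \<and>
      mat_kernel (m_DMP_inverse A) = mat_kernel (A ^\<^sub>m k * minkowski_inverse A))
     \<and>
     ((\<exists>!X. is_outer_inverse_TS A
              (mat_range (A ^\<^sub>m k)) (mat_kernel (A ^\<^sub>m k * minkowski_inverse A)) X) \<and>
      m_DMP_inverse A =
        outer_inverse_TS A
          (mat_range (A ^\<^sub>m k)) (mat_kernel (A ^\<^sub>m k * minkowski_inverse A)))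
     \<and>
     (complementary_subspaces n
        (mat_range (A ^\<^sub>m k)) (mat_kernel (A ^\<^sub>m k * minkowski_inverse A)) \<and>
      A * m_DMP_inverse A =
        projector n
          (mat_range (A ^\<^sub>m k)) (mat_kernel (A ^\<^sub>m k * minkowski_inverse A)))
     \<and>
     (complementary_subspaces n (mat_range (A ^\<^sub>m k)) (mat_kernel (A ^\<^sub>m k)) \<and>
      m_DMP_inverse A * A = drazin_inverse A * A \<and>
      drazin_inverse A * A = projector n (mat_range (A ^\<^sub>m k)) (mat_kernel (A ^\<^sub>m k)))"
proof -
  note assoc = assoc_mult_mat[of _ n n _ n _ n] mult_carrier_mat[of _ n n _ n]
  note A = assms(1)
  define D M B where "D = drazin_inverse A" and "M = minkowski_inverse A" and "B = A ^\<^sub>m k"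
  have D: "D \<in> carrier_mat n n" and DAD: "D * A * D = D" and AD: "A * D = D * A"
    and BAD: "B * A * D = B"
    using drazin_inverse_is_drazin_inverse[OF A] A assms(2)
    unfolding is_drazin_inverse_def D_def[symmetric] B_def by auto
  have M: "M \<in> carrier_mat n n" and AMA: "A * M * A = A"
    using minkowski_inverse_is_minkowski_inverse[OF A assms(3)] A
    unfolding is_minkowski_inverse_def M_def[symmetric] by auto
  have B: "B \<in> carrier_mat n n" using A by (simp add: B_def)
  obtain W where W: "W \<in> carrier_mat n n" "D * A = B * W" and V: "D * A = W * B"
    using drazin_projection_factors[OF A D DAD AD, of k] unfolding B_def by blast
  define E X where "E = D * A" and "X = D * A * M"
  have E: "E \<in> carrier_mat n n" and X: "X \<in> carrier_mat n n"
    using A D M by (simp_all add: E_def X_def assoc)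
  have EM: "X = E * M" by (simp add: E_def X_def)
  have EE: "E * E = E"
  proof -
    have "E * E = D * A * D * A" unfolding E_def using A D by (simp add: assoc)
    then show ?thesis by (simp only: DAD E_def)
  qed
  have EW: "E = B * W" and EV: "E = W * B" using W V by (simp_all only: E_def)
  have BE: "B * E = B"
    using BAD assoc_mult_mat[OF B A D] by (simp only: E_def AD)
  have EB: "E * B = B"
  proof -
    have "E * B = B * (W * B)" unfolding EW using B W(1) by (simp add: assoc)
    then show ?thesis by (simp only: EV[symmetric] BE)
  qed
  have XA: "X * A = E"
  proof -
    have "X * A = D * (A * M * A)" unfolding X_def using A D M by (simp add: assoc)
    then show ?thesis by (simp only: AMA E_def)
  qed
  have XAX: "X * A * X = X"
  proof -
    have "X * A * X = (E * E) * M" unfolding XA unfolding EM using E M by (simp add: assoc)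
    then show ?thesis by (simp only: EE EM)
  qed
  have BX: "B * X = B * M"
    unfolding EM using assoc_mult_mat[OF B E M] by (simp only: BE)
  define F where "F = A * X"
  have F: "F \<in> carrier_mat n n" using A X by (simp add: F_def)
  have FF: "F * F = F"
  proof -
    have "F * F = A * (X * A * X)" unfolding F_def using A X by (simp add: assoc)
    then show ?thesis by (simp only: XAX F_def)
  qed
  have XF: "X = X * F"
    unfolding F_def assoc_mult_mat[OF X A X, symmetric] XAX ..
  \<comment> \<open>\<open>E\<close> starts with \<open>B\<close>, and \<open>A\<close> can be moved past \<open>B\<close>\<close>
  have FB: "F = B * (A * W * M)"
  proof -
    have "F = A * B * W * M" unfolding F_def EM EW using A B W(1) M by (simp add: assoc)
    also have "A * B = B * A" unfolding B_def by (rule pow_mat_commute[OF A A])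
    finally show ?thesis using A B W(1) M by (simp add: assoc)
  qed
  \<comment> \<open>\<open>X * A = E\<close> and \<open>E * D = D\<close>, so \<open>F * (A * D) = A * D = E\<close>, which fixes \<open>B\<close>\<close>
  have BF: "B = F * (A * D * B)"
  proof -
    have "F * (A * D * B) = A * ((X * A) * D) * B" unfolding F_def using A B D X by (simp add: assoc)
    also have "(X * A) * D = D" unfolding XA E_def by (rule DAD)
    finally show ?thesis by (simp only: AD E_def[symmetric] EB)
  qed
  have XB: "X = B * (W * M)" unfolding EM EW using B W(1) M by (simp add: assoc)
  have BXAB: "B = X * (A * B)" unfolding assoc_mult_mat[OF X A B, symmetric] XA EB ..
  have XBM: "X = W * (B * M)" unfolding EM EV using B W(1) M by (simp add: assoc)
  have range_X: "mat_range X = mat_range B"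
    by (rule mat_range_eq_if_mutual_factors[OF X B _ _ XB BXAB]) (use A B W(1) M in auto)
  have kernel_X: "mat_kernel X = mat_kernel (B * M)"
    by (rule mat_kernel_eq_if_mutual_factors[OF X _ W(1) B XBM BX[symmetric]]) (use B M in auto)
  have range_F: "mat_range F = mat_range B"
    by (rule mat_range_eq_if_mutual_factors[OF F B _ _ FB BF])
      (use A B D W(1) M in \<open>auto intro!: mult_carrier_mat\<close>)
  have kernel_F: "mat_kernel F = mat_kernel (B * M)"
    using mat_kernel_eq_if_mutual_factors[OF F X A X F_def XF] kernel_X by simp
  have range_E: "mat_range E = mat_range B"
    by (rule mat_range_eq_if_mutual_factors[OF E B W(1) B EW EB[symmetric]])
  have kernel_E: "mat_kernel E = mat_kernel B"
    by (rule mat_kernel_eq_if_mutual_factors[OF E B W(1) B EV BE[symmetric]])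
  have rank_X: "mat_rank X = mat_rank B"
    using mat_rank_mono[OF X B] mat_rank_mono[OF B X] range_X by simp
  have outer: "is_outer_inverse_TS A (mat_range B) (mat_kernel (B * M)) X"
    unfolding is_outer_inverse_TS_def is_outer_inverse_def
    using A X XAX range_X kernel_X by auto
  have unique: "Y = X" if "is_outer_inverse_TS A (mat_range B) (mat_kernel (B * M)) Y" for Y
    using that outer outer_inverse_unique[OF A] unfolding is_outer_inverse_TS_def by blast
  have X_eq: "m_DMP_inverse A = X" by (simp add: m_DMP_inverse_def X_def D_def M_def)
  show ?thesis
    unfolding X_eq B_def[symmetric] M_def[symmetric] D_def[symmetric] E_def[symmetric] XA
      F_def[symmetric] outer_inverse_TS_def
  proof (intro conjI)
    show "\<exists>!Y. is_outer_inverse_TS A (mat_range B) (mat_kernel (B * M)) Y"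
      using outer unique by blast
    show "X = (THE Y. is_outer_inverse_TS A (mat_range B) (mat_kernel (B * M)) Y)"
      by (rule the_equality[symmetric], rule outer, rule unique)
    show "complementary_subspaces n (mat_range B) (mat_kernel (B * M))"
      "F = projector n (mat_range B) (mat_kernel (B * M))"
      using idempotent_projector[OF F FF] range_F kernel_F by simp_all
    show "complementary_subspaces n (mat_range B) (mat_kernel B)"
      "E = projector n (mat_range B) (mat_kernel B)"
      using idempotent_projector[OF E EE] range_E kernel_E by simp_all
  qed (use rank_X range_X kernel_X in simp_all)
qed

end
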